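(* A ternary groupoid $(A,[\,])$ is a knot-theoretic ternary group derived from a binary group if and only if it satisfies $[[abc]de]=[[adc]be]$ for all $a,b,c,d,e\in A$ and each element of $A$ is neutral.
   Context: A ternary groupoid $(A,[\,])$ is a non-empty set $A$ with a ternary operation $[\,]\colon A^3\to A$. It is a ternary quasigroup if for all $a,b,c\in A$ each of the equations $[zab]=c$, $[azb]=c$, $[abz]=c$ has a unique solution $z\in A$. A ternary group is a ternary quasigroup that is associative: $[[abc]de]=[a[bcd]e]=[ab[cde]]$ for all $a,b,c,d,e\in A$. A knot-theoretic ternary group is a ternary group such that, for all $a,b,c,d\in A$, $[[abc]cd]=[[ab[bcd]][bcd]d]$ and $[ab[bcd]]=[a[abc][[abc]cd]]$. A ternary group $(A,[\,])$ is derived from a binary group $(A,* )$ (on the same set) if $[xyz]=x*y*z$ for all $x,y,z\in A$. An element $e\in A$ is neutral if $[eea]=[eae]=[aee]=a$ for every $a\in A$. *)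

theory Defs
  imports "HOL-Algebra.Group"
begin

locale ternary_groupoid =
  fixes A :: "'a set"
    and t :: "'a \<Rightarrow> 'a \<Rightarrow> 'a \<Rightarrow> 'a"  ("[_,/ _,/ _]\<^sub>t")
  assumes nonempty: "A \<noteq> {}"
    and closed: "\<lbrakk>a \<in> A; b \<in> A; c \<in> A\<rbrakk> \<Longrightarrow> [a, b, c]\<^sub>t \<in> A"

locale ternary_quasigroup = ternary_groupoid +
  assumes left_solvable:
      "\<lbrakk>a \<in> A; b \<in> A; c \<in> A\<rbrakk> \<Longrightarrow> \<exists>!z. z \<in> A \<and> [z, a, b]\<^sub>t = c"
    and middle_solvable:
      "\<lbrakk>a \<in> A; b \<in> A; c \<in> A\<rbrakk> \<Longrightarrow> \<exists>!z. z \<in> A \<and> [a, z, b]\<^sub>t = c"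
    and right_solvable:
      "\<lbrakk>a \<in> A; b \<in> A; c \<in> A\<rbrakk> \<Longrightarrow> \<exists>!z. z \<in> A \<and> [a, b, z]\<^sub>t = c"

locale ternary_group = ternary_quasigroup +
  assumes assoc_left_middle:
      "\<lbrakk>a \<in> A; b \<in> A; c \<in> A; d \<in> A; e \<in> A\<rbrakk>
        \<Longrightarrow> [[a, b, c]\<^sub>t, d, e]\<^sub>t = [a, [b, c, d]\<^sub>t, e]\<^sub>t"
    and assoc_middle_right:
      "\<lbrakk>a \<in> A; b \<in> A; c \<in> A; d \<in> A; e \<in> A\<rbrakk>
        \<Longrightarrow> [a, [b, c, d]\<^sub>t, e]\<^sub>t = [a, b, [c, d, e]\<^sub>t]\<^sub>t"

locale knot_theoretic_ternary_group = ternary_group +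
  assumes knot_left:
      "\<lbrakk>a \<in> A; b \<in> A; c \<in> A; d \<in> A\<rbrakk>
        \<Longrightarrow> [[a, b, c]\<^sub>t, c, d]\<^sub>t = [[a, b, [b, c, d]\<^sub>t]\<^sub>t, [b, c, d]\<^sub>t, d]\<^sub>t"
    and knot_right:
      "\<lbrakk>a \<in> A; b \<in> A; c \<in> A; d \<in> A\<rbrakk>
        \<Longrightarrow> [a, b, [b, c, d]\<^sub>t]\<^sub>t = [a, [a, b, c]\<^sub>t, [[a, b, c]\<^sub>t, c, d]\<^sub>t]\<^sub>t"

definition derived_from_group ::
    "'a set \<Rightarrow> ('a \<Rightarrow> 'a \<Rightarrow> 'a \<Rightarrow> 'a) \<Rightarrow> ('a, 'm) monoid_scheme \<Rightarrow> bool" where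
  "derived_from_group A t G \<longleftrightarrow>
    group G \<and> carrier G = A \<and>
    (\<forall>x\<in>A. \<forall>y\<in>A. \<forall>z\<in>A. t x y z = x \<otimes>\<^bsub>G\<^esub> y \<otimes>\<^bsub>G\<^esub> z)"

definition ternary_neutral ::
    "'a set \<Rightarrow> ('a \<Rightarrow> 'a \<Rightarrow> 'a \<Rightarrow> 'a) \<Rightarrow> 'a \<Rightarrow> bool" where
  "ternary_neutral A t e \<longleftrightarrow>
    e \<in> A \<and> (\<forall>a\<in>A. t e e a = a \<and> t e a e = a \<and> t a e e = a)"

end

theory Submission
  imports Defs
begin

text \<open>
  In a group, the first knot-theoretic law cancels to \<open>c c = (b c d) (b c d)\<close>, which at
  \<open>c = d = \<one>\<close> says that every square is trivial; hence the group is abelian, and both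
  conditions on the right-hand side follow. Conversely, neutrality and the exchange law force the
  operation to be invariant under all permutations of its arguments, so for any fixed \<open>e\<close> the
  product \<open>x * y = [x e y]\<close> is an abelian group of exponent two with identity \<open>e\<close>, and
  \<open>x * y * z = [[x e y] e z] = [x y z]\<close>.
\<close>

text \<open>Every element is its own inverse, so inverting \<open>x \<otimes> y\<close> only
  reverses its factors.\<close>

lemma (in group) comm_group_of_squares_trivial:
  assumes "\<And>x. x \<in> carrier G \<Longrightarrow> x \<otimes> x = \<one>"
  shows "comm_group G"
proof (rule group_comm_groupI)
  fix x y assume xy: "x \<in> carrier G" "y \<in> carrier G"
  have "inv z = z" if "z \<in> carrier G" for z
    using assms[OF that] that by (simp add: inv_equality)
  then show "x \<otimes> y = y \<otimes> x"
    using inv_mult_group[of x y] xy by simp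
qed

lemma derived_mult:
  assumes "derived_from_group A t G" "x \<in> A" "y \<in> A" "z \<in> A"
  shows "t x y z = x \<otimes>\<^bsub>G\<^esub> y \<otimes>\<^bsub>G\<^esub> z"
  using assms by (simp add: derived_from_group_def)

lemma knot_theoretic_derived_squares_trivial:
  assumes "knot_theoretic_ternary_group A t" and D: "derived_from_group A t G"
    and x: "x \<in> carrier G"
  shows "x \<otimes>\<^bsub>G\<^esub> x = \<one>\<^bsub>G\<^esub>"
proof -
  interpret knot_theoretic_ternary_group A t by fact
  interpret G: group G using D by (simp add: derived_from_group_def)
  have car: "carrier G = A" using D by (simp add: derived_from_group_def)
  note [simp] = derived_mult[OF D] car[symmetric]
  have "\<one>\<^bsub>G\<^esub> = x \<otimes>\<^bsub>G\<^esub> x"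
    \<comment> \<open>This instance reads \<open>x = x x x\<close>; cancel one
      \<open>x\<close>.\<close>
    using knot_left[of "\<one>\<^bsub>G\<^esub>" x "\<one>\<^bsub>G\<^esub>" "\<one>\<^bsub>G\<^esub>"] x
    by (simp add: G.m_assoc)
  then show ?thesis by simp
qed

text \<open>Both directions pass through this setting: the forward one with the given group, the
  converse with a pointed group.\<close>

context
  fixes A :: "'a set" and t :: "'a \<Rightarrow> 'a \<Rightarrow> 'a \<Rightarrow> 'a" and G :: "('a, 'm) monoid_scheme"
  assumes derived: "derived_from_group A t G"
    and squares: "\<And>x. x \<in> carrier G \<Longrightarrow> x \<otimes>\<^bsub>G\<^esub> x = \<one>\<^bsub>G\<^esub>"
begin

interpretation comm_group G
  using derived squares
  by (intro group.comm_group_of_squares_trivial) (simp_all add: derived_from_group_def)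

lemma derived_carrier: "A = carrier G"
  using derived by (simp add: derived_from_group_def)

text \<open>Removes a repeated factor inside a right-nested product; with \<open>squares\<close> and
  \<open>m_ac\<close>, rewriting then settles the identities below.\<close>

lemma square_cancel: "x \<in> carrier G \<Longrightarrow> y \<in> carrier G \<Longrightarrow> x \<otimes>\<^bsub>G\<^esub> (x \<otimes>\<^bsub>G\<^esub> y) = y"
  using squares by (simp flip: m_assoc)

lemmas exponent_two_simps =
  derived_mult[OF derived, unfolded derived_carrier] squares square_cancel m_ac

lemma exponent_two_exchange:
  "\<lbrakk>a \<in> A; b \<in> A; c \<in> A; d \<in> A; e \<in> A\<rbrakk> \<Longrightarrow> t (t a b c) d e = t (t a d c) b e"
  by (simp add: derived_carrier exponent_two_simps)

lemma exponent_two_neutral: "e \<in> A \<Longrightarrow> ternary_neutral A t e"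
  by (simp add: derived_carrier ternary_neutral_def exponent_two_simps)

text \<open>Factors commute and are their own inverses, so moving \<open>a\<close> and
  \<open>b\<close> across gives one solution for all three positions.\<close>

lemma exponent_two_solution_iff:
  assumes "a \<in> A" "b \<in> A" "c \<in> A" "z \<in> A"
  shows "t z a b = c \<longleftrightarrow> z = t a b c" "t a z b = c \<longleftrightarrow> z = t a b c"
    "t a b z = c \<longleftrightarrow> z = t a b c"
  using assms by (auto simp: derived_carrier exponent_two_simps)

lemma exponent_two_knot_theoretic: "knot_theoretic_ternary_group A t"
proof
  show "A \<noteq> {}"
    by (auto simp: derived_carrier)
  show cl: "t a b c \<in> A" if "a \<in> A" "b \<in> A" "c \<in> A" for a b c
    using that by (simp add: derived_carrier exponent_two_simps)
  fix a b c assume abc: "a \<in> A" "b \<in> A" "c \<in> A"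
  show "\<exists>!z. z \<in> A \<and> t z a b = c" "\<exists>!z. z \<in> A \<and> t a z b = c" "\<exists>!z. z \<in> A \<and> t a b z = c"
    using cl[OF abc] exponent_two_solution_iff[OF abc] by auto
  fix d assume d: "d \<in> A"
  \<comment> \<open>Repeated factors cancel: both sides become \<open>a b d\<close> in the first law
    and \<open>a c d\<close> in the second.\<close>
  show "t (t a b c) c d = t (t a b (t b c d)) (t b c d) d"
    "t a b (t b c d) = t a (t a b c) (t (t a b c) c d)"
    using abc d by (simp_all add: derived_carrier exponent_two_simps)
  fix e assume "e \<in> A"
  then show "t (t a b c) d e = t a (t b c d) e" "t a (t b c d) e = t a b (t c d e)"
    using abc d by (simp_all add: derived_carrier exponent_two_simps)
qed

end

locale exchange_ternary = ternary_groupoid +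
  assumes exchange: "\<lbrakk>a \<in> A; b \<in> A; c \<in> A; d \<in> A; e \<in> A\<rbrakk>
      \<Longrightarrow> [[a, b, c]\<^sub>t, d, e]\<^sub>t = [[a, d, c]\<^sub>t, b, e]\<^sub>t"
    and neutral: "e \<in> A \<Longrightarrow> ternary_neutral A t e"
begin

lemma neutral_simps [simp]:
  assumes "e \<in> A" "a \<in> A"
  shows "[e, e, a]\<^sub>t = a" "[e, a, e]\<^sub>t = a" "[a, e, e]\<^sub>t = a"
  using neutral[OF assms(1)] assms by (auto simp: ternary_neutral_def)

text \<open>Exchanging \<open>b\<close> with the second \<open>c\<close> creates
  \<open>[a, c, c]\<^sub>t\<close>, which is \<open>a\<close> by neutrality.\<close>

lemma cancel:
  "\<lbrakk>a \<in> A; b \<in> A; c \<in> A; d \<in> A\<rbrakk> \<Longrightarrow> [[a, b, c]\<^sub>t, c, d]\<^sub>t = [a, b, d]\<^sub>t"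
  using exchange[of a b c c d] by simp

text \<open>Exchange in \<open>[[c, c, a]\<^sub>t, b, c]\<^sub>t\<close>; neutrality of
  \<open>c\<close> collapses both sides.\<close>

lemma swap_outer: "\<lbrakk>a \<in> A; b \<in> A; c \<in> A\<rbrakk> \<Longrightarrow> [a, b, c]\<^sub>t = [c, b, a]\<^sub>t"
  using exchange[of c c a b c] by (simp add: closed)

text \<open>Write \<open>b\<close> as \<open>[[a, b, c]\<^sub>t, c, a]\<^sub>t\<close> inside
  \<open>[b, a, c]\<^sub>t\<close> and cancel. With \<open>swap_outer\<close> this generates all
  permutations of the arguments.\<close>

lemma swap_left:
  assumes "a \<in> A" "b \<in> A" "c \<in> A"
  shows "[a, b, c]\<^sub>t = [b, a, c]\<^sub>t"
proof -
  have "[[a, b, c]\<^sub>t, c, a]\<^sub>t = b"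
    using cancel[of a b c a] assms by simp
  then have "[b, a, c]\<^sub>t = [[[a, b, c]\<^sub>t, c, a]\<^sub>t, a, c]\<^sub>t"
    by simp
  also have "\<dots> = [a, b, c]\<^sub>t"
    using cancel[of "[a, b, c]\<^sub>t" c a c] assms by (simp add: closed)
  finally show ?thesis ..
qed

definition pointed_group :: "'a \<Rightarrow> 'a monoid" where
  "pointed_group e = \<lparr>carrier = A, mult = \<lambda>x y. [x, e, y]\<^sub>t, one = e\<rparr>"

text \<open>Moving the first \<open>e\<close> outward puts it next to the second, so
  \<open>cancel\<close> removes both.\<close>

lemma pointed_triple_product:
  assumes "e \<in> A" "x \<in> A" "y \<in> A" "z \<in> A"
  shows "[[x, e, y]\<^sub>t, e, z]\<^sub>t = [x, y, z]\<^sub>t"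
proof -
  have "[x, e, y]\<^sub>t = [x, y, e]\<^sub>t"
    using assms by (metis swap_left swap_outer)
  then show ?thesis
    using assms by (simp add: cancel)
qed

lemma group_pointed_group:
  assumes e: "e \<in> A"
  shows "group (pointed_group e)"
proof (rule groupI)
  fix x y z
  assume "x \<in> carrier (pointed_group e)" "y \<in> carrier (pointed_group e)"
    "z \<in> carrier (pointed_group e)"
  then have xyz: "x \<in> A" "y \<in> A" "z \<in> A" by (simp_all add: pointed_group_def)
  \<comment> \<open>Swapping the outer arguments gives a left-nested product, to which
    \<open>pointed_triple_product\<close> applies.\<close>
  have "[x, e, [y, e, z]\<^sub>t]\<^sub>t = [[y, e, z]\<^sub>t, e, x]\<^sub>t"
    using xyz e by (simp add: swap_outer[of x] closed)
  also have "\<dots> = [y, z, x]\<^sub>t"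
    using xyz e by (simp add: pointed_triple_product)
  also have "\<dots> = [x, y, z]\<^sub>t"
    using xyz by (metis swap_left swap_outer)
  finally show "x \<otimes>\<^bsub>pointed_group e\<^esub> y \<otimes>\<^bsub>pointed_group e\<^esub> z
      = x \<otimes>\<^bsub>pointed_group e\<^esub> (y \<otimes>\<^bsub>pointed_group e\<^esub> z)"
    using xyz e by (simp add: pointed_group_def pointed_triple_product)
next
  fix x assume "x \<in> carrier (pointed_group e)"
  \<comment> \<open>Neutrality of \<open>x\<close> makes \<open>x\<close> its own inverse.\<close>
  then show "\<exists>y\<in>carrier (pointed_group e). y \<otimes>\<^bsub>pointed_group e\<^esub> x = \<one>\<^bsub>pointed_group e\<^esub>"
    using e by (intro bexI[of _ x]) (simp_all add: pointed_group_def)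
qed (use e in \<open>simp_all add: pointed_group_def closed\<close>)

lemma derived_from_pointed_group:
  "e \<in> A \<Longrightarrow> derived_from_group A t (pointed_group e)"
  using group_pointed_group
  by (simp add: derived_from_group_def pointed_triple_product pointed_group_def)

lemma pointed_group_squares_trivial:
  "\<lbrakk>e \<in> A; x \<in> carrier (pointed_group e)\<rbrakk> \<Longrightarrow>
    x \<otimes>\<^bsub>pointed_group e\<^esub> x = \<one>\<^bsub>pointed_group e\<^esub>"
  by (simp add: pointed_group_def)

end

theorem theorem5p5:
  fixes A :: "'a set" and t :: "'a \<Rightarrow> 'a \<Rightarrow> 'a \<Rightarrow> 'a"
  assumes "ternary_groupoid A t"
  shows "(knot_theoretic_ternary_group A t \<and> (\<exists>G :: 'a monoid. derived_from_group A t G))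
    \<longleftrightarrow>
    ((\<forall>a\<in>A. \<forall>b\<in>A. \<forall>c\<in>A. \<forall>d\<in>A. \<forall>e\<in>A. t (t a b c) d e = t (t a d c) b e)
      \<and> (\<forall>e\<in>A. ternary_neutral A t e))" (is "?L \<longleftrightarrow> ?R")
proof
  assume ?L
  then obtain G :: "'a monoid"
    where K: "knot_theoretic_ternary_group A t" and D: "derived_from_group A t G"
    by blast
  note squares = knot_theoretic_derived_squares_trivial[OF K D]
  show ?R
    using exponent_two_exchange[OF D squares] exponent_two_neutral[OF D squares] by blast
next
  assume ?R
  then interpret exchange_ternary A t
    using assms unfolding exchange_ternary_def exchange_ternary_axioms_def by blast
  obtain e where e: "e \<in> A" using nonempty by blast
  note D = derived_from_pointed_group[OF e]
  show ?L
    using D exponent_two_knot_theoretic[OF D pointed_group_squares_trivial[OF e]] by blast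
qed

end
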